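(* Let $\mu\in\mathcal{P}(\mathbb{I})$ be an ergodic, weak Renyi measure for $G$ which is doubling at $0$, and let $f:\mathbb{N}\to(0,\infty)$ be such that $nf(n)\downarrow0$ as $n\uparrow\infty$. (i) If $\sum_{n\ge1}\frac{\mu((0,nf(n)))}{n}<\infty$, then for $\mu$-a.e. $x\in\mathbb{I}$, $$\frac{\min_{p}|x-\frac pq|}{f(q)/q}\xrightarrow[q\to\infty]{}\infty.$$ (ii) If $\mathbb{E}_\mu(\log a)<\infty$ and $\sum_{n\ge1}\frac{\mu((0,nf(n)))}{n}=\infty$, then for $\mu$-a.e. $x\in\mathbb{I}$, $$\liminf_{q\to\infty}\frac{\min_{p}|x-\frac pq|}{f(q)/q}=0.$$
   Context: $\mathbb{N}=\{1,2,\dots\}$; $q$ ranges over $\mathbb{N}$ and the minimum is over integers $p$. $\mathbb{I}:=[0,1]\setminus\mathbb{Q}$, $\mathcal{P}(\mathbb{I})$ is the set of Borel probability measures on $\mathbb{I}$, and $\mu((0,r))$ means $\mu((0,r)\cap\mathbb{I})$. $G:\mathbb{I}\to\mathbb{I}$, $G(x):=\frac1x-\lfloor\frac1x\rfloor$ is the Gauss map, $a(x):=\lfloor\frac1x\rfloor$, and $\mathbb{E}_\mu$ denotes integration with respect to $\mu$. "$nf(n)\downarrow0$" means that $nf(n)$ is nonincreasing in $n$ and tends to $0$. Weak Renyi measure. A $G$-invariant $\mu\in\mathcal{P}(\mathbb{I})$ is a weak Renyi measure for $G$ if there is $M>1$ such that for all $n\ge1$, all $A\in\sigma(\{a\circ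 G^k:0\le k\le n\})$ and all $B\in\sigma(\{a\circ G^\ell:\ell\ge n+1\})$, $\mu(A\cap B)\le M\mu(A)\mu(B)$. It is ergodic if $(\mathbb{I},\mu,G)$ is ergodic. Doubling at $0$. $\mu$ is doubling at $0$ if there are $M>1$ and $r_0>0$ such that $\mu((0,2r))\le M\mu((0,r))$ for all $0<r\le r_0$. *)

theory Defs
  imports "HOL-Probability.Probability"
begin

definition unit_irrationals :: "real set" where
  "unit_irrationals = {0..1} - \<rat>"

definition borel_prob_on_irrationals :: "real measure \<Rightarrow> bool" where
  "borel_prob_on_irrationals \<mu> \<longleftrightarrow>
     prob_space \<mu> \<and> sets \<mu> = sets (restrict_space borel unit_irrationals)"

definition gauss_map :: "real \<Rightarrow> real" where
  "gauss_map x = 1 / x - of_int \<lfloor>1 / x\<rfloor>"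

definition cf_digit :: "real \<Rightarrow> nat" where
  "cf_digit x = nat \<lfloor>1 / x\<rfloor>"

definition measure_preserving_map :: "'a measure \<Rightarrow> ('a \<Rightarrow> 'a) \<Rightarrow> bool" where
  "measure_preserving_map M T \<longleftrightarrow> T \<in> measurable M M \<and> distr M M T = M"

definition ergodic_map :: "'a measure \<Rightarrow> ('a \<Rightarrow> 'a) \<Rightarrow> bool" where
  "ergodic_map M T \<longleftrightarrow> measure_preserving_map M T \<and>
     (\<forall>A\<in>sets M. T -` A \<inter> space M = A \<longrightarrow> measure M A = 0 \<or> measure M A = 1)"

text \<open>The \<open>\<sigma>\<close>-algebra on the unit irrationals generated by the functions
  \<open>cf_digit \<circ> gauss_map ^^ k\<close> with \<open>k \<in> K\<close>, the digits carrying the discrete \<open>\<sigma>\<close>-algebra.\<close>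

definition digit_events :: "nat set \<Rightarrow> real set set" where
  "digit_events K = sigma_sets unit_irrationals
     {(cf_digit \<circ> gauss_map ^^ k) -` S \<inter> unit_irrationals | k S. k \<in> K}"

definition weak_Renyi_measure :: "real measure \<Rightarrow> bool" where
  "weak_Renyi_measure \<mu> \<longleftrightarrow>
     borel_prob_on_irrationals \<mu> \<and> measure_preserving_map \<mu> gauss_map \<and>
     (\<exists>M>1. \<forall>n\<ge>1. \<forall>A\<in>digit_events {0..n}. \<forall>B\<in>digit_events {n+1..}.
        measure \<mu> (A \<inter> B) \<le> M * measure \<mu> A * measure \<mu> B)"

text \<open>Since \<open>\<mu>\<close> lives on the unit irrationals, \<open>\<mu>((0,r))\<close> is the measure of the trace; without the
  intersection \<^const>\<open>measure\<close> would be evaluated at a non-measurable set and return 0.\<close>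

definition mass_near_0 :: "real measure \<Rightarrow> real \<Rightarrow> real" where
  "mass_near_0 \<mu> r = measure \<mu> ({0<..<r} \<inter> unit_irrationals)"

definition doubling_at_0 :: "real measure \<Rightarrow> bool" where
  "doubling_at_0 \<mu> \<longleftrightarrow>
     (\<exists>M>1. \<exists>r\<^sub>0>0. \<forall>r. 0 < r \<and> r \<le> r\<^sub>0 \<longrightarrow> mass_near_0 \<mu> (2 * r) \<le> M * mass_near_0 \<mu> r)"

text \<open>The minimum ranges over the infinite set of all integers, so \<^const>\<open>Min\<close> does not apply; the
  lemma shows that the least element exists.\<close>

definition min_dist_fraction :: "real \<Rightarrow> nat \<Rightarrow> real" where
  "min_dist_fraction x q = (LEAST d. \<exists>p::int. d = \<bar>x - of_int p / of_nat q\<bar>)"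

lemma min_dist_fraction_attained:
  assumes "q \<ge> 1"
  shows "\<exists>p::int. min_dist_fraction x q = \<bar>x - of_int p / of_nat q\<bar> \<and>
           (\<forall>p'::int. \<bar>x - of_int p / of_nat q\<bar> \<le> \<bar>x - of_int p' / of_nat q\<bar>)"
proof -
  define p where "p = round (of_nat q * x)"
  have scale: "\<bar>x - of_int k / of_nat q\<bar> = \<bar>of_nat q * x - of_int k\<bar> / of_nat q" for k :: int
  proof -
    have "x - of_int k / of_nat q = (of_nat q * x - of_int k) / of_nat q"
      using assms by (simp add: field_simps)
    then show ?thesis by simp
  qed
  have least: "\<bar>x - of_int p / of_nat q\<bar> \<le> \<bar>x - of_int p' / of_nat q\<bar>" for p' :: int
    unfolding scale p_def using round_diff_minimal[of "of_nat q * x" p']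
    by (intro divide_right_mono) auto
  have "min_dist_fraction x q = \<bar>x - of_int p / of_nat q\<bar>"
    unfolding min_dist_fraction_def by (rule Least_equality) (use least in auto)
  with least show ?thesis by blast
qed

definition approx_ratio :: "(nat \<Rightarrow> real) \<Rightarrow> real \<Rightarrow> nat \<Rightarrow> real" where
  "approx_ratio f x q = min_dist_fraction x q / (f q / of_nat q)"

end

theory Submission
  imports Defs
begin

text \<open>Write \<open>x\<^sub>n = G\<^sup>n x\<close> and \<open>\<psi> n = n f n\<close>. For the convergents \<open>p\<^sub>n / q\<^sub>n\<close> of \<open>x\<close>, the number
  \<open>q\<^sub>n \<bar>q\<^sub>n x - p\<^sub>n\<bar>\<close> lies between \<open>x\<^sub>n / 2\<close> and \<open>x\<^sub>n\<close>, and convergents are best approximations, so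
  everything depends on how often \<open>x\<^sub>n\<close> is smaller than a multiple of \<open>\<psi> q\<^sub>n\<close>. By invariance
  \<open>x\<^sub>n < r\<close> has probability \<open>\<mu> (0, r)\<close>. Since \<open>q\<^sub>n\<close> grows at least exponentially, Cauchy condensation
  and the first Borel-Cantelli lemma give (i). If \<open>log a\<close> is integrable, \<open>q\<^sub>n\<close> grows at most
  exponentially, and the weak Renyi property makes the events \<open>a (x\<^sub>n) \<ge> k\<^sub>n\<close> pairwise quasi-independent,
  so that infinitely many occur with positive probability; for nondecreasing \<open>k\<^sub>n\<close> the limsup set is
  contained in its \<open>G\<close>-preimage, hence has full measure by ergodicity.\<close>

section \<open>Quasi-independent events and ergodic maps\<close>

text \<open>Second-moment argument: the number \<open>S\<close> of occurring events has mean
  \<open>s\<close> and second moment at most \<open>C * s\<^sup>2 + s\<close>, and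
  \<open>1 \<le> s\<close> absorbs the linear term into \<open>(C + 1) * s\<^sup>2\<close>. The
  resulting bound depends on neither \<open>J\<close> nor \<open>s\<close>.\<close>

lemma (in prob_space) quasi_independent_union_ge:
  fixes E :: "nat \<Rightarrow> 'a set"
  assumes E: "\<And>n. E n \<in> events" and J: "finite J"
    and C: "0 \<le> C" "\<And>m n. m < n \<Longrightarrow> prob (E m \<inter> E n) \<le> C * prob (E m) * prob (E n)"
    and s: "1 \<le> (\<Sum>n\<in>J. prob (E n))"
  shows "1 / (C + 1) \<le> prob (\<Union>n\<in>J. E n)"
proof -
  define S where "S x = (\<Sum>n\<in>J. indicat_real (E n) x)" for x
  define s where "s = (\<Sum>n\<in>J. prob (E n))"
  \<comment> \<open>This \<open>t\<close> maximises
    \<open>2 * t * s - t\<^sup>2 * ((C + 1) * s\<^sup>2)\<close>; the maximum is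
    \<open>1 / (C + 1)\<close>.\<close>
  define t where "t = 1 / ((C + 1) * s)"
  have s1: "1 \<le> s" using s by (simp add: s_def)
  have sq: "(S x)\<^sup>2 = (\<Sum>m\<in>J. \<Sum>n\<in>J. indicat_real (E m \<inter> E n) x)" for x
    by (simp add: S_def power2_eq_square sum_product indicator_inter_arith)
  have [measurable]: "E n \<in> events" for n by (rule E)
  have int1: "integrable M S" and int2: "integrable M (\<lambda>x. (S x)\<^sup>2)"
    unfolding S_def sq[unfolded S_def]
    by (auto intro!: Bochner_Integration.integrable_sum integrable_real_indicator simp: emeasure_eq_measure)
  have ES: "expectation S = s"
    unfolding S_def s_def by (subst Bochner_Integration.integral_sum) (auto simp: emeasure_eq_measure)
  \<comment> \<open>Quasi-independence is given for \<open>m < n\<close> and extends by symmetry;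
    the extra summand pays for the diagonal.\<close>
  have pair: "prob (E m \<inter> E n) \<le> C * prob (E m) * prob (E n) + (if m = n then prob (E m) else 0)" for m n
  proof (cases m n rule: linorder_cases)
    case greater
    then show ?thesis using C(2)[of n m] by (simp add: Int_commute mult_ac)
  qed (use C in auto)
  have "expectation (\<lambda>x. (S x)\<^sup>2) = (\<Sum>m\<in>J. \<Sum>n\<in>J. prob (E m \<inter> E n))"
    unfolding sq
    by (subst Bochner_Integration.integral_sum, force simp: emeasure_eq_measure,
        rule sum.cong[OF refl], subst Bochner_Integration.integral_sum) (auto simp: emeasure_eq_measure)
  also have "\<dots> \<le> (\<Sum>m\<in>J. \<Sum>n\<in>J. C * prob (E m) * prob (E n) + (if m = n then prob (E m) else 0))"
    by (intro sum_mono pair)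
  also have "\<dots> = C * s\<^sup>2 + s"
    using J by (simp add: sum.distrib s_def power2_eq_square sum_product sum_distrib_left mult_ac)
  finally have ES2: "expectation (\<lambda>x. (S x)\<^sup>2) \<le> C * s\<^sup>2 + s" .
  \<comment> \<open>This pointwise bound replaces the Cauchy-Schwarz step of the Kochen-Stone argument.\<close>
  have "2 * t * S x - t\<^sup>2 * (S x)\<^sup>2 \<le> indicat_real (\<Union>n\<in>J. E n) x" for x
  proof (cases "x \<in> (\<Union>n\<in>J. E n)")
    case True
    have "0 \<le> (1 - t * S x)\<^sup>2" by simp
    then show ?thesis using True by (simp add: power2_eq_square algebra_simps)
  next
    case False
    then have "S x = 0" by (auto simp: S_def indicator_def intro!: sum.neutral)
    then show ?thesis using False by simp
  qed
  then have "expectation (\<lambda>x. 2 * t * S x - t\<^sup>2 * (S x)\<^sup>2) \<le> expectation (indicat_real (\<Union>n\<in>J. E n))"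
    using int1 int2 J by (intro integral_mono) (auto simp: emeasure_eq_measure)
  also have "\<dots> = prob (\<Union>n\<in>J. E n)"
    using E sets.sets_into_space[OF E] by (simp add: Int_absorb2 UN_subset_iff)
  also have "expectation (\<lambda>x. 2 * t * S x - t\<^sup>2 * (S x)\<^sup>2) = 2 * t * s - t\<^sup>2 * expectation (\<lambda>x. (S x)\<^sup>2)"
    using int1 int2 ES by simp
  finally have "2 * t * s - t\<^sup>2 * expectation (\<lambda>x. (S x)\<^sup>2) \<le> prob (\<Union>n\<in>J. E n)" .
  moreover have "t\<^sup>2 * expectation (\<lambda>x. (S x)\<^sup>2) \<le> t\<^sup>2 * ((C + 1) * s\<^sup>2)"
  proof (intro mult_left_mono)
    have "s \<le> s\<^sup>2" using s1 by (simp add: power2_eq_square)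
    with ES2 show "expectation (\<lambda>x. (S x)\<^sup>2) \<le> (C + 1) * s\<^sup>2"
      by (simp add: algebra_simps)
  qed simp
  moreover have "t * s = 1 / (C + 1)"
    using s1 by (simp add: t_def)
  moreover have "t\<^sup>2 * ((C + 1) * s\<^sup>2) = (C + 1) * (t * s)\<^sup>2"
    by (simp add: power_mult_distrib)
  moreover have "(C + 1) * (1 / (C + 1))\<^sup>2 = 1 / (C + 1)"
    using C(1) by (simp add: power2_eq_square)
  ultimately show ?thesis by simp
qed

text \<open>Every tail of a divergent series has a finite block of sum above 1, so every tail union
  has probability at least \<open>1 / (C + 1)\<close>. Continuity from above passes this bound to
  the limsup set.\<close>

lemma (in prob_space) quasi_independent_limsup_pos:
  fixes E :: "nat \<Rightarrow> 'a set"
  assumes E: "\<And>n. E n \<in> events"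
    and C: "0 \<le> C" "\<And>m n. m < n \<Longrightarrow> prob (E m \<inter> E n) \<le> C * prob (E m) * prob (E n)"
    and div: "\<not> summable (\<lambda>n. prob (E n))"
  shows "0 < prob (\<Inter>N. \<Union>n\<in>{N..}. E n)"
proof -
  have [measurable]: "E n \<in> events" for n by (rule E)
  have "1 / (C + 1) \<le> prob (\<Union>n\<in>{N..}. E n)" for N
  proof -
    have "\<not> (\<forall>K. (\<Sum>n<K. prob (E (n + N))) \<le> 1)"
    proof
      assume "\<forall>K. (\<Sum>n<K. prob (E (n + N))) \<le> 1"
      then have "summable (\<lambda>n. prob (E (n + N)))"
        by (intro summableI_nonneg_bounded[of _ 1]) auto
      with div show False using summable_iff_shift[of "\<lambda>n. prob (E n)" N] by simp
    qed
    then obtain K where "1 < (\<Sum>n<K. prob (E (n + N)))" by (auto simp: not_le)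
    also have "\<dots> = (\<Sum>n\<in>{N..<K + N}. prob (E n))"
      using sum.shift_bounds_nat_ivl[of "\<lambda>n. prob (E n)" 0 N K] by (simp add: lessThan_atLeast0)
    finally have "1 / (C + 1) \<le> prob (\<Union>n\<in>{N..<K + N}. E n)"
      by (intro quasi_independent_union_ge E C) auto
    also have "\<dots> \<le> prob (\<Union>n\<in>{N..}. E n)"
      by (intro finite_measure_mono) auto
    finally show ?thesis .
  qed
  moreover have "(\<lambda>N. prob (\<Union>n\<in>{N..}. E n)) \<longlonglongrightarrow> prob (\<Inter>N. \<Union>n\<in>{N..}. E n)"
    by (intro finite_Lim_measure_decseq) (auto simp: decseq_def intro: order_trans)
  ultimately have "1 / (C + 1) \<le> prob (\<Inter>N. \<Union>n\<in>{N..}. E n)"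
    by (intro LIMSEQ_le_const) auto
  moreover have "0 < 1 / (C + 1)" using C(1) by simp
  ultimately show ?thesis by linarith
qed

section \<open>Measure preserving and ergodic maps\<close>

lemma measure_preserving_map_funpow:
  assumes "measure_preserving_map M T"
  shows "measure_preserving_map M (T ^^ n)"
proof (induction n)
  case 0
  show ?case by (simp add: measure_preserving_map_def distr_id2)
next
  case (Suc n)
  then have "distr M M (T \<circ> T ^^ n) = distr (distr M M (T ^^ n)) M T"
    using assms by (subst distr_distr) (auto simp: measure_preserving_map_def)
  with Suc assms show ?case
    unfolding measure_preserving_map_def funpow.simps by (auto intro: measurable_comp)
qed

lemma measure_preserving_map_vimage:
  assumes "measure_preserving_map M T" "A \<in> sets M"
  shows "T -` A \<inter> space M \<in> sets M" "measure M (T -` A \<inter> space M) = measure M A"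
  using assms measure_distr[of T M M A]
  by (auto simp: measure_preserving_map_def)

text \<open>The preimages of \<open>L\<close> under the iterates increase and all have the measure
  of \<open>L\<close>, so their union has it too. The union is strictly invariant, as the definition
  of ergodicity demands.\<close>

lemma ergodic_map_subinvariant:
  assumes "prob_space M" and erg: "ergodic_map M T"
    and L: "L \<in> sets M" "L \<subseteq> T -` L" "0 < measure M L"
  shows "measure M L = 1"
proof -
  interpret prob_space M by fact
  have mp: "measure_preserving_map M T" using erg by (simp add: ergodic_map_def)
  define A where "A k = (T ^^ k) -` L \<inter> space M" for k
  have Tsp: "T x \<in> space M" if "x \<in> space M" for x
    using mp that by (auto simp: measure_preserving_map_def measurable_def)
  have Am: "A k \<in> sets M" "prob (A k) = prob L" for k
    using measure_preserving_map_vimage[OF measure_preserving_map_funpow[OF mp] L(1)]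
    by (auto simp: A_def)
  have AS: "A k \<subseteq> A (Suc k)" for k using L(2) by (auto simp: A_def)
  then have "incseq A" by (rule incseq_SucI)
  then have "(\<lambda>k. prob (A k)) \<longlonglongrightarrow> prob (\<Union>k. A k)"
    by (intro finite_Lim_measure_incseq) (use Am in auto)
  then have eq: "prob (\<Union>k. A k) = prob L"
    unfolding Am by (simp add: LIMSEQ_const_iff)
  have "T -` A k \<inter> space M = A (Suc k)" for k
    using Tsp by (auto simp: A_def simp del: funpow.simps simp: funpow_Suc_right)
  then have "T -` (\<Union>k. A k) \<inter> space M = (\<Union>k. A (Suc k))" by auto
  also have "\<dots> = (\<Union>k. A k)" using AS by blast
  finally have "prob (\<Union>k. A k) = 0 \<or> prob (\<Union>k. A k) = 1"
    using erg Am by (auto simp: ergodic_map_def)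
  with eq L(3) show ?thesis by auto
qed

text \<open>Let \<open>B\<close> be the invariant set on which the Birkhoff sums are unbounded above, and let
  \<open>m\<^sub>n\<close> be the maximum of \<open>0\<close> and the first \<open>n\<close> of them. Then
  \<open>m\<^sub>n\<^sub>+\<^sub>1 - m\<^sub>n \<circ> T = max g (- m\<^sub>n \<circ> T)\<close> has nonnegative integral and, if \<open>B\<close> has full measure,
  tends to \<open>g\<close>, which is impossible.\<close>

lemma ergodic_map_birkhoff_sums_bounded:
  fixes g :: "'a \<Rightarrow> real"
  assumes "prob_space M" and erg: "ergodic_map M T"
    and g: "integrable M g" "integral\<^sup>L M g < 0"
  shows "AE x in M. \<exists>K. \<forall>n. (\<Sum>i<n. g ((T ^^ i) x)) \<le> K"
proof -
  interpret prob_space M by fact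
  have mp: "measure_preserving_map M T" using erg by (simp add: ergodic_map_def)
  then have T [measurable]: "T \<in> measurable M M" and distr: "distr M M T = M"
    by (auto simp: measure_preserving_map_def)
  have gm [measurable]: "g \<in> borel_measurable M" using g by auto
  have Tsp: "T x \<in> space M" if "x \<in> space M" for x
    using T that by (auto simp: measurable_def)
  have TN [measurable]: "(T ^^ i) \<in> measurable M M" for i
    using measure_preserving_map_funpow[OF mp] by (auto simp: measure_preserving_map_def)
  have intT: "integrable M (\<lambda>x. h (T x))" "(\<integral>x. h (T x) \<partial>M) = integral\<^sup>L M h"
    if "integrable M h" for h :: "'a \<Rightarrow> real"
    using integrable_distr[of T M M h] integral_distr[of T M M h] that distr by auto
  define S where "S n x = (\<Sum>i<n. g ((T ^^ i) x))" for n x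
  have S0: "S 0 x = 0" for x by (simp add: S_def)
  have SS: "S (Suc n) x = g x + S n (T x)" for n x
    unfolding S_def by (subst sum.lessThan_Suc_shift) (simp add: funpow_swap1)
  have Sm [measurable]: "S n \<in> borel_measurable M" for n unfolding S_def by measurable
  \<comment> \<open>Natural thresholds make \<open>B\<close> a countable combination of measurable
    sets; \<open>unb\<close> returns to real ones, which suit the proof of invariance.\<close>
  define B where "B = {x \<in> space M. \<forall>K::nat. \<exists>n. real K < S n x}"
  have Bm: "B \<in> sets M" unfolding B_def by measurable
  have unb: "(\<forall>K::nat. \<exists>n. real K < S n x) \<longleftrightarrow> (\<forall>K::real. \<exists>n. K < S n x)" for x
    by (meson le_less_trans real_arch_simple)
  have "T x \<in> B \<longleftrightarrow> x \<in> B" if "x \<in> space M" for x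
  proof -
    have "(\<forall>K::real. \<exists>n. K < S n (T x)) \<longleftrightarrow> (\<forall>K::real. \<exists>n. K < S n x)"
    proof safe
      fix K :: real assume "\<forall>K. \<exists>n. K < S n (T x)"
      then obtain n where "K - g x < S n (T x)" by blast
      then show "\<exists>n. K < S n x" by (intro exI[of _ "Suc n"]) (simp add: SS)
    next
      fix K :: real assume "\<forall>K. \<exists>n. K < S n x"
      \<comment> \<open>The \<open>max\<close> with 0 excludes \<open>n = 0\<close>, where the sum
        vanishes, so the first summand can be split off.\<close>
      then obtain n where n: "max 0 (K + g x) < S n x" by blast
      then obtain k where "n = Suc k" using S0 by (cases n) auto
      with n show "\<exists>n. K < S n (T x)" by (intro exI[of _ k]) (simp add: SS)
    qed
    then show ?thesis using that Tsp unfolding B_def unb by auto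
  qed
  then have "T -` B \<inter> space M = B" by (auto simp: B_def)
  with erg Bm have "prob B = 0 \<or> prob B = 1" by (auto simp: ergodic_map_def)
  moreover have "prob B \<noteq> 1"
  proof
    assume "prob B = 1"
    then have aeB: "AE x in M. x \<in> B" using Bm by (simp add: prob_eq_1)
    \<comment> \<open>The running maximum is built by the recursion that \<open>SS\<close> suggests,
      so that its properties follow by induction.\<close>
    define m where "m n = (rec_nat (\<lambda>x. 0) (\<lambda>_ h x. max 0 (g x + h (T x))) n :: 'a \<Rightarrow> real)" for n
    have m0: "m 0 x = 0" and mS: "m (Suc n) x = max 0 (g x + m n (T x))" for n x
      by (auto simp: m_def)
    have mint: "integrable M (m n)" for n
    proof (induction n)
      case 0
      show ?case by (simp add: m_def)
    next
      case (Suc n)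
      then have "integrable M (\<lambda>x. max 0 (g x + m n (T x)))"
        using g(1) intT by (intro integrable_max) auto
      moreover have "m (Suc n) = (\<lambda>x. max 0 (g x + m n (T x)))" using mS by blast
      ultimately show ?case by simp
    qed
    have mpos: "0 \<le> m n x" for n x by (cases n) (auto simp: m0 mS)
    have mmono: "m n x \<le> m (Suc n) x" for n x
    proof (induction n arbitrary: x)
      case (Suc n)
      show ?case using Suc[of "T x"] unfolding mS[of "Suc n"] mS[of n] by auto
    qed (simp add: m0 mpos)
    have mge: "S n x \<le> m n x" for n x
    proof (induction n arbitrary: x)
      case (Suc n)
      show ?case using Suc[of "T x"] by (simp add: SS mS)
    qed (simp add: m0 S0)
    define d where "d n x = max (g x) (- m n (T x))" for n x
    have d: "d n x = m (Suc n) x - m n (T x)" for n x by (simp add: d_def mS)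
    have "0 \<le> integral\<^sup>L M (d n)" for n
    proof -
      have "integral\<^sup>L M (d n) = integral\<^sup>L M (m (Suc n)) - integral\<^sup>L M (m n)"
        unfolding d using mint intT[OF mint] by simp
      moreover have "integral\<^sup>L M (m n) \<le> integral\<^sup>L M (m (Suc n))"
        by (intro integral_mono mint mmono)
      ultimately show ?thesis by simp
    qed
    moreover have "(\<lambda>n. integral\<^sup>L M (d n)) \<longlonglongrightarrow> integral\<^sup>L M g"
    proof (rule integral_dominated_convergence[where w = "\<lambda>x. \<bar>g x\<bar>"])
      show "d n \<in> borel_measurable M" for n
        unfolding d_def using borel_measurable_integrable[OF mint[of n]] by measurable
      \<comment> \<open>As \<open>m n\<close> is nonnegative, \<open>d n\<close> lies between
        \<open>g\<close> and \<open>max 0 g\<close>.\<close>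
      show "AE x in M. norm (d n x) \<le> \<bar>g x\<bar>" for n
      proof (rule AE_I2)
        fix x
        show "norm (d n x) \<le> \<bar>g x\<bar>" using mpos[of n "T x"] by (auto simp: d_def)
      qed
      show "AE x in M. (\<lambda>n. d n x) \<longlonglongrightarrow> g x"
        using aeB
      proof eventually_elim
        case (elim x)
        then have "T x \<in> B" using \<open>T -` B \<inter> space M = B\<close> by auto
        then obtain n where "\<bar>g x\<bar> < S n (T x)" unfolding B_def unb by blast
        then have n: "\<bar>g x\<bar> < m n (T x)" using mge[of n "T x"] by linarith
        have "d k x = g x" if "n \<le> k" for k
        proof -
          have "m n (T x) \<le> m k (T x)"
            using lift_Suc_mono_le[of "\<lambda>n. m n (T x)", OF mmono that] .
          with n show ?thesis by (auto simp: d_def)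
        qed
        then show ?case by (intro tendsto_eventually) (auto simp: eventually_sequentially)
      qed
    qed (use g in auto)
    ultimately have "0 \<le> integral\<^sup>L M g" by (intro LIMSEQ_le_const) auto
    with g(2) show False by simp
  qed
  ultimately have "prob B = 0" by blast
  then have "AE x in M. x \<notin> B" using Bm by (simp add: AE_iff_measurable prob_eq_0)
  then show ?thesis
    using AE_space
  proof eventually_elim
    case (elim x)
    then show ?case by (auto simp: B_def S_def not_less)
  qed
qed

section \<open>Series: repeated terms and Cauchy condensation\<close>

lemma summable_div_nat:
  fixes g :: "nat \<Rightarrow> real"
  assumes "summable g" "\<And>n. 0 \<le> g n" "0 < k"
  shows "summable (\<lambda>n. g (n div k))"
proof (rule summableI_nonneg_bounded)
  fix n
  have "(\<Sum>i<n. g (i div k)) \<le> (\<Sum>i<n * k. g (i div k))"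
    using assms by (intro sum_mono2) (auto intro: less_le_trans)
  also have "\<dots> = (\<Sum>m<n. \<Sum>i\<in>{m * k..<m * k + k}. g (i div k))"
    by (rule sum.nat_group[symmetric])
  \<comment> \<open>On the m-th block \<open>i div k\<close> is constantly \<open>m\<close>, so each
    value is counted exactly \<open>k\<close> times.\<close>
  also have "\<dots> = (\<Sum>m<n. \<Sum>i\<in>{m * k..<m * k + k}. g m)"
    using assms(3) by (intro sum.cong refl arg_cong[of _ _ g]) (auto simp: div_nat_eqI mult_ac)
  also have "\<dots> = k * (\<Sum>m<n. g m)" by (simp add: sum_distrib_left)
  also have "\<dots> \<le> k * suminf g"
    using assms by (intro mult_left_mono sum_le_suminf) auto
  finally show "(\<Sum>i<n. g (i div k)) \<le> k * suminf g" .
qed (rule assms)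

text \<open>Cauchy condensation: the factor \<open>2 ^ k\<close> cancels the weight. Monotonicity is
  asked only from 1 on, since the intended \<open>\<phi>\<close> is built from
  \<open>n f(n)\<close>, which is 0 at \<open>n = 0\<close>.\<close>

lemma summable_inverse_weight_iff:
  fixes \<phi> :: "nat \<Rightarrow> real"
  assumes "\<And>m n. 1 \<le> m \<Longrightarrow> m \<le> n \<Longrightarrow> \<phi> n \<le> \<phi> m" "\<And>n. 0 \<le> \<phi> n"
  shows "summable (\<lambda>n. \<phi> (Suc n) / real (Suc n)) \<longleftrightarrow> summable (\<lambda>k. \<phi> (2 ^ k))"
proof -
  have "summable (\<lambda>n. \<phi> (Suc n) / real (Suc n)) \<longleftrightarrow> summable (\<lambda>n. \<phi> n / real n)"
    by (rule summable_Suc_iff)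
  also have "\<dots> \<longleftrightarrow> summable (\<lambda>k. 2 ^ k * (\<phi> (2 ^ k) / real (2 ^ k)))"
    using assms by (intro condensation_test) (auto intro!: frac_le)
  finally show ?thesis by simp
qed

section \<open>Continued fractions\<close>

lemma unit_irrationals_bounds:
  assumes "x \<in> unit_irrationals"
  shows "0 < x" "x < 1" "x \<notin> \<rat>"
  using assms by (auto simp: unit_irrationals_def less_le)

lemma gauss_map_irrational:
  assumes "x \<in> unit_irrationals"
  shows "gauss_map x \<in> unit_irrationals"
proof -
  have "1 / x \<notin> \<rat>"
    using Rats_divide[of 1 "1 / x"] unit_irrationals_bounds[OF assms] by auto
  then have "1 / x - of_int \<lfloor>1 / x\<rfloor> \<notin> \<rat>"
    using Rats_add[of "1 / x - of_int \<lfloor>1 / x\<rfloor>" "of_int \<lfloor>1 / x\<rfloor>"] by auto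
  then show ?thesis
    using floor_correct[of "1 / x"]
    by (auto simp: gauss_map_def unit_irrationals_def algebra_simps less_imp_le)
qed

lemma gauss_map_funpow_irrational:
  assumes "x \<in> unit_irrationals"
  shows "(gauss_map ^^ n) x \<in> unit_irrationals"
  by (induction n) (auto simp: assms gauss_map_irrational)

lemma of_nat_cf_digit:
  assumes "x \<in> unit_irrationals"
  shows "real (cf_digit x) = of_int \<lfloor>1 / x\<rfloor>"
  using unit_irrationals_bounds[OF assms] by (simp add: cf_digit_def)

lemma cf_digit_ge_iff:
  assumes "x \<in> unit_irrationals"
  shows "k \<le> cf_digit x \<longleftrightarrow> real k * x \<le> 1"
proof -
  have "k \<le> cf_digit x \<longleftrightarrow> int k \<le> \<lfloor>1 / x\<rfloor>"
    using unit_irrationals_bounds[OF assms] by (auto simp: cf_digit_def nat_le_iff le_nat_iff)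
  also have "\<dots> \<longleftrightarrow> real k * x \<le> 1"
    using unit_irrationals_bounds[OF assms] by (simp add: le_floor_iff field_simps)
  finally show ?thesis .
qed

lemma cf_digit_ge_1: "x \<in> unit_irrationals \<Longrightarrow> 1 \<le> cf_digit x"
  using unit_irrationals_bounds[of x] by (simp add: cf_digit_ge_iff)

lemma gauss_map_eq:
  assumes "x \<in> unit_irrationals"
  shows "x * gauss_map x = 1 - real (cf_digit x) * x"
  using unit_irrationals_bounds[OF assms]
  by (simp add: gauss_map_def of_nat_cf_digit[OF assms] field_simps)

text \<open>Indices are shifted by one against the usual \<open>p\<^sub>n / q\<^sub>n\<close>, so that the recursion starts at
  \<open>p\<^sub>-\<^sub>1 / q\<^sub>-\<^sub>1 = 1 / 0\<close>.\<close>

fun cf_num :: "real \<Rightarrow> nat \<Rightarrow> nat" where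
  "cf_num x 0 = 1"
| "cf_num x (Suc 0) = 0"
| "cf_num x (Suc (Suc n)) = cf_digit ((gauss_map ^^ n) x) * cf_num x (Suc n) + cf_num x n"

fun cf_den :: "real \<Rightarrow> nat \<Rightarrow> nat" where
  "cf_den x 0 = 0"
| "cf_den x (Suc 0) = 1"
| "cf_den x (Suc (Suc n)) = cf_digit ((gauss_map ^^ n) x) * cf_den x (Suc n) + cf_den x n"

text \<open>Up to sign this is \<open>q x - p\<close> for the shifted convergents, see
  \<open>cf_den_mult_minus_cf_num\<close>; the product form makes positivity and monotonicity
  immediate.\<close>

definition cf_gap :: "real \<Rightarrow> nat \<Rightarrow> real" where
  "cf_gap x n = (\<Prod>i<n. (gauss_map ^^ i) x)"

lemma cf_gap_0 [simp]: "cf_gap x 0 = 1"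
  by (simp add: cf_gap_def)

lemma cf_gap_Suc: "cf_gap x (Suc n) = cf_gap x n * (gauss_map ^^ n) x"
  by (simp add: cf_gap_def)

lemma cf_gap_pos: "x \<in> unit_irrationals \<Longrightarrow> 0 < cf_gap x n"
  unfolding cf_gap_def
  by (intro prod_pos) (auto intro: unit_irrationals_bounds gauss_map_funpow_irrational)

lemma cf_gap_Suc_le:
  assumes "x \<in> unit_irrationals"
  shows "cf_gap x (Suc n) \<le> cf_gap x n"
proof -
  have "(gauss_map ^^ n) x \<le> 1"
    using unit_irrationals_bounds(2)[OF gauss_map_funpow_irrational[OF assms]] less_imp_le by blast
  then show ?thesis
    using cf_gap_pos[OF assms, of n] by (simp add: cf_gap_Suc mult_left_le)
qed

text \<open>This is \<open>gauss_map_eq\<close> at the n-th iterate. Up to alternating signs it is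
  the recursion of numerators and denominators.\<close>

lemma cf_gap_Suc_Suc:
  assumes "x \<in> unit_irrationals"
  shows "cf_gap x (Suc (Suc n)) = cf_gap x n - cf_digit ((gauss_map ^^ n) x) * cf_gap x (Suc n)"
proof -
  have "cf_gap x (Suc (Suc n)) = cf_gap x n * ((gauss_map ^^ n) x * gauss_map ((gauss_map ^^ n) x))"
    by (simp add: cf_gap_Suc)
  then show ?thesis
    unfolding gauss_map_eq[OF gauss_map_funpow_irrational[OF assms]]
    by (simp add: cf_gap_Suc algebra_simps)
qed

text \<open>Both sides obey the same two-step recursion, the alternating sign absorbing the minus in
  \<open>cf_gap_Suc_Suc\<close>. Consecutive errors thus have opposite signs.\<close>

lemma cf_den_mult_minus_cf_num:
  fixes x :: real
  assumes "x \<in> unit_irrationals"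
  shows "real (cf_den x n) * x - real (cf_num x n) = (-1) ^ Suc n * cf_gap x n"
proof (induction n rule: induct_nat_012)
  case (ge2 n)
  let ?a = "real (cf_digit ((gauss_map ^^ n) x))"
  have "real (cf_den x (Suc (Suc n))) * x - real (cf_num x (Suc (Suc n)))
      = ?a * (real (cf_den x (Suc n)) * x - real (cf_num x (Suc n)))
        + (real (cf_den x n) * x - real (cf_num x n))"
    by (simp add: algebra_simps)
  also have "real (cf_den x (Suc n)) * x - real (cf_num x (Suc n)) = (-1) ^ Suc (Suc n) * cf_gap x (Suc n)"
    using ge2 by simp
  also have "real (cf_den x n) * x - real (cf_num x n) = (-1) ^ Suc n * cf_gap x n"
    using ge2 by simp
  finally show ?case
    by (simp add: cf_gap_Suc_Suc[OF assms] algebra_simps)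
qed (auto simp: cf_gap_Suc)

text \<open>The digit terms of the two recursions cancel, so the left side does not depend on
  \<open>n\<close>. It yields both \<open>cf_den_gap_le\<close> and
  \<open>cf_den_gap_ge\<close>.\<close>

lemma cf_den_gap_identity:
  assumes "x \<in> unit_irrationals"
  shows "cf_den x (Suc n) * cf_gap x n + cf_den x n * cf_gap x (Suc n) = 1"
proof (induction n)
  case (Suc n)
  then show ?case
    by (simp add: cf_gap_Suc_Suc[OF assms] algebra_simps)
qed simp

text \<open>Stated over the integers so that consecutive convergents form a lattice basis in
  \<open>cf_best_approximation\<close>.\<close>

lemma cf_determinant:
  "int (cf_den x (Suc n)) * int (cf_num x n) - int (cf_den x n) * int (cf_num x (Suc n)) = (-1) ^ n"
proof (induction n)
  case (Suc n)
  then show ?case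
    by (simp add: algebra_simps)
qed simp

lemma cf_den_le_Suc:
  assumes "x \<in> unit_irrationals"
  shows "cf_den x n \<le> cf_den x (Suc n)"
proof (cases n)
  case (Suc m)
  then show ?thesis
    using cf_digit_ge_1[OF gauss_map_funpow_irrational[OF assms, of m]] by (simp add: trans_le_add1)
qed simp

lemma cf_den_mono:
  assumes "x \<in> unit_irrationals" "m \<le> n"
  shows "cf_den x m \<le> cf_den x n"
  using lift_Suc_mono_le[of "cf_den x", OF cf_den_le_Suc[OF assms(1)] assms(2)] .

text \<open>All digits are at least 1, so a denominator at least doubles in every two steps.\<close>

lemma cf_den_ge_power:
  assumes "x \<in> unit_irrationals"
  shows "2 ^ (n div 2) \<le> cf_den x (Suc n)"
proof (induction n rule: nat_induct2)
  case 1
  then show ?case using cf_digit_ge_1[OF assms] by simp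
next
  case (step n)
  have "cf_den x (Suc n) \<le> cf_digit ((gauss_map ^^ Suc n) x) * cf_den x (Suc (Suc n))"
    using cf_den_le_Suc[OF assms, of "Suc n"]
      mult_le_mono1[OF cf_digit_ge_1[OF gauss_map_funpow_irrational[OF assms, of "Suc n"]],
        of "cf_den x (Suc (Suc n))"] by linarith
  moreover have "2 ^ ((n + 2) div 2) = 2 * 2 ^ (n div 2)"
    by simp
  ultimately show ?case
    using step by simp
qed simp

text \<open>Denominators are nondecreasing, so each recursion step multiplies by at most twice the
  digit. The logarithm of the bound is a Birkhoff sum of \<open>log a\<close> plus
  \<open>n ln 2\<close>.\<close>

lemma cf_den_le_prod:
  assumes "x \<in> unit_irrationals"
  shows "real (cf_den x (Suc n)) \<le> (\<Prod>i<n. 2 * real (cf_digit ((gauss_map ^^ i) x)))"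
proof (induction n)
  case (Suc n)
  let ?a = "cf_digit ((gauss_map ^^ n) x)"
  have "cf_den x n \<le> ?a * cf_den x (Suc n)"
    using cf_den_le_Suc[OF assms, of n]
      mult_le_mono1[OF cf_digit_ge_1[OF gauss_map_funpow_irrational[OF assms, of n]],
        of "cf_den x (Suc n)"] by linarith
  then have "cf_den x (Suc (Suc n)) \<le> (2 * ?a) * cf_den x (Suc n)"
    by (simp add: mult_ac)
  then have "real (cf_den x (Suc (Suc n))) \<le> real (2 * ?a) * real (cf_den x (Suc n))"
    unfolding of_nat_mult[symmetric] of_nat_le_iff .
  also have "\<dots> \<le> real (2 * ?a) * (\<Prod>i<n. 2 * real (cf_digit ((gauss_map ^^ i) x)))"
    by (intro mult_left_mono Suc.IH) simp
  finally show ?case by (simp add: mult_ac)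
qed simp

lemma cf_den_gap_le:
  assumes "x \<in> unit_irrationals"
  shows "cf_den x (Suc n) * cf_gap x (Suc n) \<le> (gauss_map ^^ n) x"
proof -
  have "cf_den x (Suc n) * cf_gap x n \<le> 1"
    using cf_den_gap_identity[OF assms, of n] cf_gap_pos[OF assms, of "Suc n"]
    by (smt (verit) mult_nonneg_nonneg of_nat_0_le_iff)
  then have "cf_den x (Suc n) * cf_gap x n * (gauss_map ^^ n) x \<le> 1 * (gauss_map ^^ n) x"
    using unit_irrationals_bounds(1)[OF gauss_map_funpow_irrational[OF assms, of n]]
    by (intro mult_right_mono) auto
  then show ?thesis by (simp add: cf_gap_Suc mult_ac)
qed

text \<open>In \<open>cf_den_gap_identity\<close> the second summand is at most the first, which is
  therefore at least 1/2.\<close>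

lemma cf_den_gap_ge:
  assumes "x \<in> unit_irrationals"
  shows "(gauss_map ^^ n) x \<le> 2 * (cf_den x (Suc n) * cf_gap x (Suc n))"
proof -
  have "cf_den x n * cf_gap x (Suc n) \<le> cf_den x (Suc n) * cf_gap x n"
    using cf_den_le_Suc[OF assms, of n] cf_gap_Suc_le[OF assms, of n] cf_gap_pos[OF assms, of "Suc n"]
    by (intro mult_mono) auto
  then have "1 \<le> 2 * (cf_den x (Suc n) * cf_gap x n)"
    using cf_den_gap_identity[OF assms, of n] by linarith
  then have "1 * (gauss_map ^^ n) x \<le> 2 * (cf_den x (Suc n) * cf_gap x n) * (gauss_map ^^ n) x"
    using unit_irrationals_bounds(1)[OF gauss_map_funpow_irrational[OF assms, of n]]
    by (intro mult_right_mono) auto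
  then show ?thesis by (simp add: cf_gap_Suc mult_ac)
qed

text \<open>Lagrange's argument: \<open>(q, p)\<close> is an integer combination of two consecutive
  convergents with coefficients \<open>u\<close> and \<open>v\<close>. The bounds on
  \<open>q\<close> force \<open>u \<noteq> 0\<close> and exclude equal signs of \<open>u\<close> and
  \<open>v\<close>; since the two errors also have opposite signs, nothing cancels.\<close>

lemma cf_best_approximation:
  fixes p :: int
  assumes x: "x \<in> unit_irrationals" and q: "1 \<le> q" "q < cf_den x (Suc (Suc n))"
  shows "cf_gap x (Suc n) \<le> \<bar>real q * x - of_int p\<bar>"
proof -
  define a b c d where "a = int (cf_den x (Suc n))" and "b = int (cf_den x (Suc (Suc n)))"
    and "c = int (cf_num x (Suc n))" and "d = int (cf_num x (Suc (Suc n)))"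
  define e :: int where "e = (-1) ^ Suc n"
  \<comment> \<open>Cramer's rule; the determinant \<open>e\<close> is its own inverse, so the
    solutions are integers.\<close>
  define u v where "u = e * (b * p - d * int q)" and "v = e * (c * int q - a * p)"
  have det: "b * c - a * d = e"
    using cf_determinant[of x "Suc n"] by (simp add: a_def b_def c_def d_def e_def)
  have ee: "e * e = 1"
    by (simp add: e_def flip: power_add)
  have uq: "u * a + v * b = int q"
  proof -
    have "u * a + v * b = e * (b * c - a * d) * int q"
      by (simp add: u_def v_def algebra_simps)
    then show ?thesis by (simp add: det ee)
  qed
  have up: "u * c + v * d = p"
  proof -
    have "u * c + v * d = e * (b * c - a * d) * p"
      by (simp add: u_def v_def algebra_simps)
    then show ?thesis by (simp add: det ee)
  qed
  have pos: "0 \<le> a" "0 \<le> b" by (auto simp: a_def b_def)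
  have v1: "u \<le> 0" if "v > 0"
  proof (rule ccontr)
    assume "\<not> u \<le> 0"
    then have "0 \<le> u * a" "b \<le> v * b"
      using that pos mult_right_mono[of 1 v b] by auto
    with uq q(2) show False unfolding b_def by linarith
  qed
  have v2: "u \<noteq> 0"
  proof
    assume "u = 0"
    then have "v * b = int q" using uq by simp
    then have "v > 0" using q pos by (smt (verit) mult_nonpos_nonneg of_nat_1 of_nat_mono)
    then have "b \<le> v * b" using pos mult_right_mono[of 1 v b] by auto
    with \<open>v * b = int q\<close> q show False unfolding b_def by linarith
  qed
  have v3: "u > 0" if "v \<le> 0"
  proof (rule ccontr)
    assume "\<not> u > 0"
    then have "u * a \<le> 0" "v * b \<le> 0"
      using that pos by (auto simp: mult_nonpos_nonneg)
    with uq q(1) show False by simp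
  qed
  have A: "of_int a * x - of_int c = (-1) ^ Suc (Suc n) * cf_gap x (Suc n)"
    and B: "of_int b * x - of_int d = - ((-1) ^ Suc (Suc n) * cf_gap x (Suc (Suc n)))"
    using cf_den_mult_minus_cf_num[OF x, of "Suc n"] cf_den_mult_minus_cf_num[OF x, of "Suc (Suc n)"]
    by (simp_all add: a_def b_def c_def d_def)
  have "real q * x - of_int p = of_int (u * a + v * b) * x - of_int (u * c + v * d)"
    unfolding uq up by simp
  also have "\<dots> = u * (of_int a * x - of_int c) + v * (of_int b * x - of_int d)"
    by (simp add: algebra_simps)
  also have "\<dots> = (-1) ^ Suc (Suc n) * (u * cf_gap x (Suc n) - v * cf_gap x (Suc (Suc n)))"
    unfolding A B by (simp add: algebra_simps)
  finally have eq: "\<bar>real q * x - of_int p\<bar> = \<bar>u * cf_gap x (Suc n) - v * cf_gap x (Suc (Suc n))\<bar>"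
    by (simp add: abs_mult power_abs)
  let ?g = "cf_gap x (Suc n)" and ?h = "cf_gap x (Suc (Suc n))"
  have g: "0 < ?g" "0 < ?h" using cf_gap_pos[OF x] by auto
  show ?thesis
  proof (cases "v > 0")
    case True
    then have "u \<le> -1" using v1 v2 by force
    then have "of_int u \<le> (-1 :: real)" by linarith
    then have "u * ?g \<le> -1 * ?g" "0 \<le> v * ?h"
      using g True mult_right_mono[of "of_int u" "-1" ?g] by auto
    then show ?thesis unfolding eq by linarith
  next
    case False
    then have "1 \<le> u" using v3 by force
    then have "1 * ?g \<le> u * ?g" "v * ?h \<le> 0"
      using g False by (auto intro!: mult_right_mono mult_nonpos_nonneg)
    then show ?thesis unfolding eq by linarith
  qed
qed

section \<open>The approximation ratio in the form \<open>\<bar>q x - p\<bar> / f q\<close>\<close>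

lemma approx_ratio_le:
  assumes "1 \<le> q" "0 < f q"
  shows "approx_ratio f x q \<le> \<bar>real q * x - of_int p\<bar> / f q"
proof -
  have "min_dist_fraction x q \<le> \<bar>x - of_int p / real q\<bar>"
    using min_dist_fraction_attained[OF assms(1), of x] by force
  also have "\<dots> = \<bar>real q * x - of_int p\<bar> / real q"
  proof -
    have "x - of_int p / real q = (real q * x - of_int p) / real q"
      using assms by (simp add: field_simps)
    then show ?thesis by simp
  qed
  finally have "min_dist_fraction x q / (f q / real q) \<le> \<bar>real q * x - of_int p\<bar> / real q / (f q / real q)"
    using assms by (intro divide_right_mono) auto
  then show ?thesis using assms by (simp add: approx_ratio_def)
qed

lemma approx_ratio_attained:
  assumes "1 \<le> q"
  obtains p :: int where "approx_ratio f x q = \<bar>real q * x - of_int p\<bar> / f q"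
proof -
  obtain p :: int where p: "min_dist_fraction x q = \<bar>x - of_int p / real q\<bar>"
    using min_dist_fraction_attained[OF assms, of x] by auto
  have "x - of_int p / real q = (real q * x - of_int p) / real q"
    using assms by (simp add: field_simps)
  then have "approx_ratio f x q = \<bar>real q * x - of_int p\<bar> / f q"
    using assms unfolding approx_ratio_def p by simp
  then show ?thesis by (rule that)
qed

section \<open>Approximation of typical points\<close>

text \<open>Iterated doubling absorbs constant factors. The radius bound shrinks to
  \<open>r\<^sub>0 / 2 ^ j\<close> so that all intermediate radii stay in the doubling
  range.\<close>

lemma doubling_at_0_power:
  assumes "doubling_at_0 \<mu>"
  obtains D r\<^sub>0 where "0 < D" "0 < r\<^sub>0"
    "\<And>r. 0 < r \<Longrightarrow> r \<le> r\<^sub>0 \<Longrightarrow> mass_near_0 \<mu> (2 ^ j * r) \<le> D * mass_near_0 \<mu> r"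
proof -
  obtain M r\<^sub>0 where M: "1 < M" "0 < r\<^sub>0"
    "\<And>r. 0 < r \<Longrightarrow> r \<le> r\<^sub>0 \<Longrightarrow> mass_near_0 \<mu> (2 * r) \<le> M * mass_near_0 \<mu> r"
    using assms unfolding doubling_at_0_def by blast
  have "mass_near_0 \<mu> (2 ^ j * r) \<le> M ^ j * mass_near_0 \<mu> r" if "0 < r" "2 ^ j * r \<le> r\<^sub>0" for r
    using that
  proof (induction j)
    case (Suc j)
    have "2 ^ j * r \<le> 2 ^ Suc j * r"
      using Suc.prems(1) by (intro mult_right_mono power_increasing) auto
    then have "2 ^ j * r \<le> r\<^sub>0" using Suc.prems(2) by linarith
    then have "mass_near_0 \<mu> (2 * (2 ^ j * r)) \<le> M * mass_near_0 \<mu> (2 ^ j * r)"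
      using Suc.prems(1) by (intro M(3)) auto
    also have "\<dots> \<le> M * (M ^ j * mass_near_0 \<mu> r)"
      using M(1) Suc.IH[OF Suc.prems(1) \<open>2 ^ j * r \<le> r\<^sub>0\<close>] by (intro mult_left_mono) auto
    finally show ?case by (simp add: mult_ac)
  qed simp
  then show ?thesis
    using M by (intro that[of "M ^ j" "r\<^sub>0 / 2 ^ j"]) (auto simp: field_simps)
qed

theorem mainTheorem5:
  fixes \<mu> :: "real measure" and f :: "nat \<Rightarrow> real"
  assumes "borel_prob_on_irrationals \<mu>"
    and "weak_Renyi_measure \<mu>"
    and "ergodic_map \<mu> gauss_map"
    and "doubling_at_0 \<mu>"
    and "\<And>n. n \<ge> 1 \<Longrightarrow> f n > 0"
    and "\<And>m n. 1 \<le> m \<Longrightarrow> m \<le> n \<Longrightarrow> real n * f n \<le> real m * f m"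
    and "(\<lambda>n. real n * f n) \<longlonglongrightarrow> 0"
  shows "(summable (\<lambda>n. mass_near_0 \<mu> (real (Suc n) * f (Suc n)) / real (Suc n)) \<longrightarrow>
            (AE x in \<mu>. filterlim (\<lambda>q. approx_ratio f x q) at_top sequentially))
       \<and> ((\<integral>\<^sup>+ x. ennreal (ln (real (cf_digit x))) \<partial>\<mu>) < \<infinity> \<and>
          \<not> summable (\<lambda>n. mass_near_0 \<mu> (real (Suc n) * f (Suc n)) / real (Suc n)) \<longrightarrow>
            (AE x in \<mu>. liminf (\<lambda>q. ereal (approx_ratio f x q)) = 0))"
proof -
  interpret prob_space \<mu> using assms(1) by (simp add: borel_prob_on_irrationals_def)
  have sets_\<mu>: "sets \<mu> = sets (restrict_space borel unit_irrationals)"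
    using assms(1) by (simp add: borel_prob_on_irrationals_def)
  have space_\<mu>: "space \<mu> = unit_irrationals"
    using sets_eq_imp_space_eq[OF sets_\<mu>] by (simp add: space_restrict_space)
  have mp: "measure_preserving_map \<mu> gauss_map"
    using assms(3) by (simp add: ergodic_map_def)
  have borel_\<mu>: "A \<inter> unit_irrationals \<in> sets \<mu>" if "A \<in> sets borel" for A
    unfolding sets_\<mu> sets_restrict_space using that by auto
  have vimage: "(gauss_map ^^ n) -` A \<inter> unit_irrationals \<in> sets \<mu>"
    "prob ((gauss_map ^^ n) -` A \<inter> unit_irrationals) = prob A" if "A \<in> sets \<mu>" for A n
    using measure_preserving_map_vimage[OF measure_preserving_map_funpow[OF mp] that]
    by (simp_all add: space_\<mu>)
  have mass_mono: "mass_near_0 \<mu> r \<le> mass_near_0 \<mu> s" if "r \<le> s" for r s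
    unfolding mass_near_0_def using that by (intro finite_measure_mono borel_\<mu>) auto
  have mass_nonneg: "0 \<le> mass_near_0 \<mu> r" for r by (simp add: mass_near_0_def)
  have f_mono: "f n \<le> f m" if "1 \<le> m" "m \<le> n" for m n
  proof -
    have "real m * f n \<le> real n * f n"
      using that assms(5)[of n] by (intro mult_right_mono) auto
    with assms(6)[OF that] have "real m * f n \<le> real m * f m" by linarith
    with that show ?thesis by simp
  qed
  define \<psi> where "\<psi> n = real n * f n" for n
  have \<psi>_pos: "0 < \<psi> n" if "1 \<le> n" for n using assms(5)[OF that] that by (simp add: \<psi>_def)
  have \<psi>_mono: "\<psi> n \<le> \<psi> m" if "1 \<le> m" "m \<le> n" for m n
    using assms(6)[OF that] by (simp add: \<psi>_def)
  have \<psi>_lim: "\<psi> \<longlonglongrightarrow> 0" using assms(7) by (simp add: \<psi>_def[abs_def])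
  have small: "eventually (\<lambda>n. \<psi> (2 ^ (h n)) \<le> r) sequentially"
    if "0 < r" "filterlim h at_top sequentially" for r and h :: "nat \<Rightarrow> nat"
  proof -
    have "filterlim (\<lambda>n. (2::nat) ^ h n) at_top sequentially"
      by (rule filterlim_compose[OF _ that(2)])
        (rule filterlim_subseq, simp add: strict_mono_def)
    then have "(\<lambda>n. \<psi> (2 ^ h n)) \<longlonglongrightarrow> 0"
      by (rule filterlim_compose[OF \<psi>_lim])
    then show ?thesis
      using that(1) by (auto dest!: order_tendstoD(2) elim: eventually_mono)
  qed
  \<comment> \<open>From here on the series is used along powers of 2, matching the exponential
    growth of the denominators.\<close>
  have condensed: "summable (\<lambda>n. mass_near_0 \<mu> (real (Suc n) * f (Suc n)) / real (Suc n))
      \<longleftrightarrow> summable (\<lambda>k. mass_near_0 \<mu> (\<psi> (2 ^ k)))"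
    using summable_inverse_weight_iff[of "\<lambda>n. mass_near_0 \<mu> (\<psi> n)"] mass_mono \<psi>_mono mass_nonneg
    by (simp add: \<psi>_def)

  \<comment> \<open>Part (i): the convergent series\<close>
  have convergent_part: "AE x in \<mu>. filterlim (\<lambda>q. approx_ratio f x q) at_top sequentially"
    if summ: "summable (\<lambda>k. mass_near_0 \<mu> (\<psi> (2 ^ k)))"
  proof -
    have half: "filterlim (\<lambda>n::nat. n div 2) at_top sequentially"
      unfolding filterlim_at_top eventually_sequentially
    proof
      fix Z :: nat
      show "\<exists>N. \<forall>n\<ge>N. Z \<le> n div 2" by (rule exI[of _ "2 * Z"]) auto
    qed
    \<comment> \<open>First Borel-Cantelli, the factor \<open>2 ^ Suc j\<close> being absorbed by
      doubling. The exponent \<open>n div 2\<close> is that of \<open>cf_den_ge_power\<close>; one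
      factor 2 will be lost to \<open>cf_den_gap_ge\<close>.\<close>
    have "AE x in \<mu>. \<exists>N. \<forall>n\<ge>N. 2 ^ Suc j * \<psi> (2 ^ (n div 2)) \<le> (gauss_map ^^ n) x" for j
    proof -
      define r where "r n = 2 ^ Suc j * \<psi> (2 ^ (n div 2))" for n
      define A where "A n = (gauss_map ^^ n) -` ({0<..<r n} \<inter> unit_irrationals) \<inter> unit_irrationals" for n
      have Am: "A n \<in> sets \<mu>" for n unfolding A_def by (intro vimage borel_\<mu>) auto
      have Ap: "prob (A n) = mass_near_0 \<mu> (r n)" for n
        unfolding A_def mass_near_0_def by (intro vimage borel_\<mu>) auto
      obtain D r\<^sub>0 where D: "0 < D" "0 < r\<^sub>0"
        "\<And>r. 0 < r \<Longrightarrow> r \<le> r\<^sub>0 \<Longrightarrow> mass_near_0 \<mu> (2 ^ Suc j * r) \<le> D * mass_near_0 \<mu> r"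
        using doubling_at_0_power[OF assms(4), of "Suc j"] by metis
      have "eventually (\<lambda>n. norm (prob (A n)) \<le> D * mass_near_0 \<mu> (\<psi> (2 ^ (n div 2)))) sequentially"
        using small[OF D(2) half]
        
      proof eventually_elim
        case (elim n)
        have "mass_near_0 \<mu> (r n) \<le> D * mass_near_0 \<mu> (\<psi> (2 ^ (n div 2)))"
          unfolding r_def by (intro D(3) \<psi>_pos elim) simp
        then show ?case by (simp add: Ap mass_nonneg)
      qed
      moreover have "summable (\<lambda>n. D * mass_near_0 \<mu> (\<psi> (2 ^ (n div 2))))"
        using summable_div_nat[OF summ mass_nonneg, of 2] by (intro summable_mult) auto
      ultimately have "summable (\<lambda>n. prob (A n))" by (rule summable_comparison_test_ev)
      then have "AE x in \<mu>. eventually (\<lambda>n. x \<in> space \<mu> - A n) sequentially"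
        by (intro borel_cantelli_AE1 Am) (auto simp: emeasure_eq_measure)
      then show ?thesis
      proof eventually_elim
        case (elim x)
        then obtain N where N: "\<And>n. N \<le> n \<Longrightarrow> x \<in> unit_irrationals - A n"
          by (auto simp: eventually_sequentially space_\<mu>)
        have "r n \<le> (gauss_map ^^ n) x" if "N \<le> n" for n
          using N[OF that] gauss_map_funpow_irrational[of x n]
            unit_irrationals_bounds(1)[of "(gauss_map ^^ n) x"]
          by (auto simp: A_def not_less)
        then show ?case by (auto simp: r_def)
      qed
    qed
    then have "AE x in \<mu>. \<forall>j. \<exists>N. \<forall>n\<ge>N. 2 ^ Suc j * \<psi> (2 ^ (n div 2)) \<le> (gauss_map ^^ n) x"
      by (simp add: AE_all_countable)
    then show ?thesis using AE_space
    proof eventually_elim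
      case (elim x)
      then have x: "x \<in> unit_irrationals" by (simp add: space_\<mu>)
      have "eventually (\<lambda>q. Z \<le> approx_ratio f x q) sequentially" for Z
      proof -
        obtain j where j: "Z < 2 ^ j" using real_arch_pow[of 2 Z] by auto
        obtain N where N: "\<And>n. N \<le> n \<Longrightarrow> 2 ^ Suc j * \<psi> (2 ^ (n div 2)) \<le> (gauss_map ^^ n) x"
          using elim by blast
        have "Z \<le> approx_ratio f x q" if q: "cf_den x (Suc N) \<le> q" for q
        proof -
          have den1: "1 \<le> cf_den x (Suc n)" for n
            using cf_den_ge_power[OF x, of n] one_le_power[of "2::nat" "n div 2"] by linarith
          then have q1: "1 \<le> q" using q le_trans by blast
          have "q < 2 ^ q" by (rule less_exp)
          also have "2 ^ q \<le> cf_den x (Suc (2 * q))" using cf_den_ge_power[OF x, of "2 * q"] by simp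
          finally have ex: "q < cf_den x (Suc (2 * q))" .
          \<comment> \<open>The first denominator beyond \<open>q\<close>. Since \<open>q\<close> is
            at least \<open>cf_den x (Suc N)\<close>, \<open>l\<close> has the form
            \<open>Suc (Suc n)\<close> with \<open>N \<le> n\<close>, and
            \<open>cf_best_approximation\<close> applies.\<close>
          define l where "l = (LEAST l. q < cf_den x l)"
          have l: "q < cf_den x l" unfolding l_def using ex by (rule LeastI)
          have "Suc N < l" using l q cf_den_mono[OF x, of l "Suc N"] by (meson leI le_less_trans less_irrefl le_trans)
          then obtain n where n: "l = Suc (Suc n)" "N \<le> n" by (cases l; cases "l - 1") auto
          have lo: "cf_den x (Suc n) \<le> q"
            using not_less_Least[of "Suc n" "\<lambda>l. q < cf_den x l"] n unfolding l_def[symmetric] by simp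
          let ?Q = "cf_den x (Suc n)"
          obtain p :: int where p: "approx_ratio f x q = \<bar>real q * x - of_int p\<bar> / f q"
            using approx_ratio_attained[OF q1] .
          \<comment> \<open>The bound on the iterate becomes one on the gap because
            \<open>\<psi>\<close> is nonincreasing; monotonicity of \<open>f\<close> then replaces
            \<open>?Q\<close> by \<open>q\<close>.\<close>
          have "2 ^ Suc j * \<psi> ?Q \<le> 2 ^ Suc j * \<psi> (2 ^ (n div 2))"
            using cf_den_ge_power[OF x, of n] by (intro mult_left_mono \<psi>_mono) auto
          also have "\<dots> \<le> 2 * (real ?Q * cf_gap x (Suc n))"
            using N[OF n(2)] cf_den_gap_ge[OF x, of n] by linarith
          finally have "real ?Q * (2 ^ j * f ?Q) \<le> real ?Q * cf_gap x (Suc n)"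
            by (simp add: \<psi>_def mult_ac)
          then have "2 ^ j * f ?Q \<le> cf_gap x (Suc n)"
            using den1[of n] by (subst (asm) mult_le_cancel_left_pos) auto
          moreover have "2 ^ j * f q \<le> 2 ^ j * f ?Q"
            using f_mono[OF den1 lo] by simp
          moreover have "cf_gap x (Suc n) \<le> \<bar>real q * x - of_int p\<bar>"
            using cf_best_approximation[OF x q1] l n by simp
          ultimately have "2 ^ j * f q \<le> \<bar>real q * x - of_int p\<bar>" by linarith
          then have "2 ^ j \<le> approx_ratio f x q"
            unfolding p using assms(5)[OF q1] by (simp add: le_divide_eq)
          with j show ?thesis by linarith
        qed
        then show ?thesis by (auto simp: eventually_sequentially)
      qed
      then show ?case by (simp add: filterlim_at_top)
    qed
  qed

  \<comment> \<open>Part (ii): the divergent series\<close>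
  have divergent_part: "AE x in \<mu>. liminf (\<lambda>q. ereal (approx_ratio f x q)) = 0"
    if fin: "(\<integral>\<^sup>+ x. ennreal (ln (real (cf_digit x))) \<partial>\<mu>) < \<infinity>"
      and div: "\<not> summable (\<lambda>k. mass_near_0 \<mu> (\<psi> (2 ^ k)))"
  proof -
    have digit_set: "{x \<in> unit_irrationals. k \<le> cf_digit x} = {..1 / real k} \<inter> unit_irrationals"
      if "1 \<le> k" for k
      using that by (auto simp: cf_digit_ge_iff field_simps)
    have digit_meas: "{x \<in> unit_irrationals. k \<le> cf_digit x} \<in> sets \<mu>" for k
    proof (cases "k = 0")
      case True
      then show ?thesis using sets.top[of \<mu>] by (simp add: space_\<mu>)
    next
      case False
      then show ?thesis using digit_set[of k] borel_\<mu>[of "{..1 / real k}"] by simp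
    qed
    define g where "g x = ln (real (cf_digit x))" for x
    have "cf_digit \<in> measurable \<mu> (count_space UNIV)"
    proof (rule measurable_count_space_eq2_countable[THEN iffD2], safe)
      fix k :: nat
      have "cf_digit -` {k} \<inter> space \<mu> =
          {x \<in> unit_irrationals. k \<le> cf_digit x} - {x \<in> unit_irrationals. Suc k \<le> cf_digit x}"
        by (auto simp: space_\<mu>)
      then show "cf_digit -` {k} \<inter> space \<mu> \<in> sets \<mu>" using digit_meas by auto
    qed auto
    then have g_meas: "g \<in> borel_measurable \<mu>"
      unfolding g_def by (rule measurable_compose) simp
    have g_int: "integrable \<mu> g"
    proof (rule integrableI_nonneg)
      show "AE x in \<mu>. 0 \<le> g x"
        by (intro AE_I2) (use cf_digit_ge_1 in \<open>auto simp: g_def space_\<mu>\<close>)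
    qed (use g_meas fin in \<open>auto simp: g_def\<close>)
    \<comment> \<open>The surplus 1 gives \<open>g - \<Lambda>\<close> the integral -1, so its
      Birkhoff sums are almost everywhere bounded above. This one-sided bound replaces the ergodic
      theorem.\<close>
    define \<Lambda> where "\<Lambda> = expectation g + 1"
    have growth: "AE x in \<mu>. \<exists>K. \<forall>n. (\<Sum>i<n. g ((gauss_map ^^ i) x) - \<Lambda>) \<le> K"
      using g_int prob_space
      by (intro ergodic_map_birkhoff_sums_bounded[OF prob_space_axioms assms(3)]) (auto simp: \<Lambda>_def)
    \<comment> \<open>\<open>2 ^ (L * n)\<close> has to be at least
      \<open>exp (n * (ln 2 + \<Lambda> + 1))\<close>: \<open>ln 2\<close> comes from the 2 in
      \<open>cf_den_le_prod\<close>, and the 1 absorbs \<open>K\<close> once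
      \<open>n \<ge> K\<close>.\<close>
    obtain J where J: "(ln 2 + \<Lambda> + 1) / ln 2 \<le> real J" using real_arch_simple by blast
    define L where "L = max J 1"
    have L: "1 \<le> L" "ln 2 + \<Lambda> + 1 \<le> real L * ln 2"
    proof -
      have "(ln 2 + \<Lambda> + 1) / ln 2 \<le> real L" using J by (simp add: L_def)
      then show "ln 2 + \<Lambda> + 1 \<le> real L * ln 2" by (simp add: divide_le_eq)
    qed (simp add: L_def)
    have den_bound: "AE x in \<mu>. eventually (\<lambda>n. cf_den x (Suc n) \<le> 2 ^ (L * n)) sequentially"
      using growth AE_space
    proof eventually_elim
      case (elim x)
      then have x: "x \<in> unit_irrationals" by (simp add: space_\<mu>)
      obtain K where K: "\<And>n. (\<Sum>i<n. g ((gauss_map ^^ i) x) - \<Lambda>) \<le> K" using elim by blast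
      have "cf_den x (Suc n) \<le> 2 ^ (L * n)" if n: "nat \<lceil>K\<rceil> \<le> n" for n
      proof -
        have a: "1 \<le> cf_digit ((gauss_map ^^ i) x)" for i
          by (intro cf_digit_ge_1 gauss_map_funpow_irrational x)
        have "ln (\<Prod>i<n. 2 * real (cf_digit ((gauss_map ^^ i) x)))
            = (\<Sum>i<n. ln 2 + g ((gauss_map ^^ i) x))"
          using a by (subst ln_prod) (auto simp: g_def ln_mult Suc_le_eq intro!: sum.cong)
        also have "\<dots> = real n * (ln 2 + \<Lambda>) + (\<Sum>i<n. g ((gauss_map ^^ i) x) - \<Lambda>)"
          by (simp add: sum.distrib sum_subtractf algebra_simps)
        also have "\<dots> \<le> real n * (ln 2 + \<Lambda> + 1)"
          using K[of n] n by (simp add: algebra_simps)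
        also have "\<dots> \<le> real n * (real L * ln 2)"
          by (intro mult_left_mono L) simp
        also have "\<dots> = ln (2 ^ (L * n))" by (simp add: ln_realpow)
        finally have "(\<Prod>i<n. 2 * real (cf_digit ((gauss_map ^^ i) x))) \<le> 2 ^ (L * n)"
          using a by (subst (asm) ln_le_cancel_iff) (auto intro!: prod_pos simp: Suc_le_eq)
        with cf_den_le_prod[OF x, of n] have "real (cf_den x (Suc n)) \<le> 2 ^ (L * n)"
          by linarith
        then show ?thesis by simp
      qed
      then show ?case unfolding eventually_sequentially by blast
    qed
    have L_lim: "filterlim (\<lambda>n. L * n) at_top sequentially"
      using L by (intro filterlim_subseq) (simp add: strict_mono_def)
    \<comment> \<open>The term at \<open>n\<close> is at most the term at
      \<open>L * (n div L)\<close>, so thinning to multiples of \<open>L\<close> keeps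
      divergence.\<close>
    have divL: "\<not> summable (\<lambda>n. mass_near_0 \<mu> (\<psi> (2 ^ (L * n))))"
    proof
      assume "summable (\<lambda>n. mass_near_0 \<mu> (\<psi> (2 ^ (L * n))))"
      then have "summable (\<lambda>n. mass_near_0 \<mu> (\<psi> (2 ^ (L * (n div L)))))"
        using L(1) by (intro summable_div_nat[where g = "\<lambda>n. mass_near_0 \<mu> (\<psi> (2 ^ (L * n)))"])
          (auto simp: mass_nonneg)
      then have "summable (\<lambda>n. mass_near_0 \<mu> (\<psi> (2 ^ n)))"
        by (rule summable_comparison_test'[where N = 0])
          (auto simp: mass_nonneg intro!: mass_mono \<psi>_mono power_increasing)
      with div show False ..
    qed
    obtain M where M: "1 < M" "\<And>n A B. 1 \<le> n \<Longrightarrow> A \<in> digit_events {0..n} \<Longrightarrow> B \<in> digit_events {n+1..}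
        \<Longrightarrow> prob (A \<inter> B) \<le> M * prob A * prob B"
      using assms(2) unfolding weak_Renyi_measure_def by blast
    have "AE x in \<mu>. frequently (\<lambda>n. 2 ^ j * (gauss_map ^^ n) x \<le> \<psi> (2 ^ (L * n))) sequentially" for j
    proof -
      \<comment> \<open>A digit of at least \<open>k n\<close> forces the iterate to be at most
        \<open>\<psi> (2 ^ (L * n)) / 2 ^ j\<close>. Bounding digits instead of points makes
        \<open>E n\<close> a digit event at time \<open>n\<close>, as the weak Renyi inequality
        requires.\<close>
      define k where "k n = nat \<lceil>2 ^ j / \<psi> (2 ^ (L * n))\<rceil>" for n
      have k_ge: "2 ^ j / \<psi> (2 ^ (L * n)) \<le> real (k n)" for n
        unfolding k_def by (rule real_nat_ceiling_ge)
      have k_pos: "1 \<le> k n" for n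
      proof -
        have "0 < 2 ^ j / \<psi> (2 ^ (L * n))" using \<psi>_pos by simp
        then show ?thesis unfolding k_def by linarith
      qed
      have k_mono: "k m \<le> k n" if "m \<le> n" for m n
        unfolding k_def using that \<psi>_pos
        by (intro nat_mono ceiling_mono divide_left_mono \<psi>_mono mult_pos_pos power_increasing) auto
      define E where "E n = {x \<in> unit_irrationals. k n \<le> cf_digit ((gauss_map ^^ n) x)}" for n
      have E_vimage: "E n = (gauss_map ^^ n) -` {x \<in> unit_irrationals. k n \<le> cf_digit x} \<inter> unit_irrationals" for n
        unfolding E_def using gauss_map_funpow_irrational by auto
      have E_meas [measurable]: "E n \<in> sets \<mu>" for n
        unfolding E_vimage by (intro vimage digit_meas)
      have E_digit: "E n \<in> digit_events K" if "n \<in> K" for n K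
      proof -
        have "E n = (cf_digit \<circ> gauss_map ^^ n) -` {k n..} \<inter> unit_irrationals"
          by (auto simp: E_def)
        then show ?thesis unfolding digit_events_def using that by (intro sigma_sets.Basic) blast
      qed
      have E_prob: "mass_near_0 \<mu> (1 / real (k n)) \<le> prob (E n)" for n
      proof -
        have "prob (E n) = prob ({..1 / real (k n)} \<inter> unit_irrationals)"
          unfolding E_vimage vimage(2)[OF digit_meas]
          by (subst digit_set[OF k_pos]) (rule refl)
        then show ?thesis
          unfolding mass_near_0_def by (auto intro!: finite_measure_mono borel_\<mu>)
      qed
      \<comment> \<open>The ceiling adds less than 1, so \<open>k n\<close> is at most
        \<open>2 ^ Suc j / \<psi> (2 ^ (L * n))\<close> once that \<open>\<psi>\<close> is at most
        1; doubling then compares \<open>prob (E n)\<close> with the divergent series.\<close>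
      have "\<not> summable (\<lambda>n. prob (E n))"
      proof
        assume S: "summable (\<lambda>n. prob (E n))"
        obtain D r\<^sub>0 where D: "0 < D" "0 < r\<^sub>0"
          "\<And>r. 0 < r \<Longrightarrow> r \<le> r\<^sub>0 \<Longrightarrow> mass_near_0 \<mu> (2 ^ Suc j * r) \<le> D * mass_near_0 \<mu> r"
          using doubling_at_0_power[OF assms(4), of "Suc j"] by metis
        have "eventually (\<lambda>n. norm (mass_near_0 \<mu> (\<psi> (2 ^ (L * n)))) \<le> D * prob (E n)) sequentially"
          using small[OF zero_less_one L_lim] small[OF D(2) L_lim]
        proof eventually_elim
          case (elim n)
          let ?r = "\<psi> (2 ^ (L * n))"
          have r: "0 < ?r" using \<psi>_pos by simp
          then have "0 < 2 ^ j / ?r" by simp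
          then have "real (k n) \<le> 2 ^ j / ?r + 1"
            unfolding k_def by linarith
          also have "\<dots> \<le> 2 ^ Suc j / ?r"
          proof -
            have "?r \<le> 2 ^ j" using elim(1) one_le_power[of "2::real" j] by linarith
            then show ?thesis using r by (simp add: field_simps)
          qed
          finally have "?r / 2 ^ Suc j \<le> 1 / real (k n)"
            using r k_pos[of n] by (simp add: field_simps)
          then have "mass_near_0 \<mu> (?r / 2 ^ Suc j) \<le> prob (E n)"
            using mass_mono E_prob order_trans by blast
          then have "D * mass_near_0 \<mu> (?r / 2 ^ Suc j) \<le> D * prob (E n)"
            using D(1) by (intro mult_left_mono) auto
          moreover have "mass_near_0 \<mu> (2 ^ Suc j * (?r / 2 ^ Suc j)) \<le> D * mass_near_0 \<mu> (?r / 2 ^ Suc j)"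
          proof (rule D(3))
            have "?r / 2 ^ Suc j \<le> ?r / 1" using r one_le_power[of "2::real" "Suc j"]
              by (intro divide_left_mono) auto
            then show "?r / 2 ^ Suc j \<le> r\<^sub>0" using elim(2) by simp
          qed (use r in simp)
          moreover have "2 ^ Suc j * (?r / 2 ^ Suc j) = ?r" by simp
          ultimately have "mass_near_0 \<mu> ?r \<le> D * prob (E n)" by simp
          then show ?case by (simp add: mass_nonneg)
        qed
        then have "summable (\<lambda>n. mass_near_0 \<mu> (\<psi> (2 ^ (L * n))))"
          by (rule summable_comparison_test_ev) (intro summable_mult S)
        with divL show False ..
      qed
      \<comment> \<open>The shift is due to the weak Renyi inequality, which is stated for
        \<open>n \<ge> 1\<close>.\<close>
      then have nsum: "\<not> summable (\<lambda>n. prob (E (Suc n)))"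
        using summable_Suc_iff[of "\<lambda>n. prob (E n)"] by simp
      define F where "F = (\<Inter>N. \<Union>n\<in>{N..}. E (Suc n))"
      have F_meas: "F \<in> sets \<mu>" unfolding F_def by measurable
      have "0 < prob F"
        unfolding F_def
      proof (rule quasi_independent_limsup_pos[OF E_meas _ _ nsum])
        show "prob (E (Suc m) \<inter> E (Suc n)) \<le> M * prob (E (Suc m)) * prob (E (Suc n))"
          if "m < n" for m n
          using that by (intro M(2)[of "Suc m"] E_digit) auto
      qed (use M in simp)
      \<comment> \<open>Applying the map lowers the time by one; as \<open>k\<close> is
        nondecreasing, the digit bound required at the earlier time is no stronger.\<close>
      moreover have "F \<subseteq> gauss_map -` F"
      proof
        fix x assume xF: "x \<in> F"
        have "\<exists>n\<ge>N. gauss_map x \<in> E (Suc n)" for N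
        proof -
          obtain n where n: "Suc N \<le> n" "x \<in> E (Suc n)" using xF unfolding F_def by fastforce
          then obtain m where m: "n = Suc m" "N \<le> m" by (cases n) auto
          have "k n \<le> k (Suc n)" by (rule k_mono) simp
          then have "gauss_map x \<in> E n"
            using n(2) gauss_map_irrational[of x] unfolding E_def
            by (auto simp: funpow_swap1)
          with m show ?thesis by auto
        qed
        then show "x \<in> gauss_map -` F" unfolding F_def by fastforce
      qed
      ultimately have "prob F = 1"
        using ergodic_map_subinvariant[OF prob_space_axioms assms(3) F_meas] by blast
      then have "AE x in \<mu>. x \<in> F" using F_meas by (simp add: prob_eq_1)
      then show ?thesis
      proof eventually_elim
        case (elim x)
        show ?case
          unfolding frequently_sequentially
        proof
          fix N
          obtain n where n: "N \<le> n" "x \<in> E (Suc n)" using elim unfolding F_def by fastforce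
          let ?y = "(gauss_map ^^ Suc n) x"
          have x: "x \<in> unit_irrationals" using n by (simp add: E_def)
          have y: "?y \<in> unit_irrationals" by (rule gauss_map_funpow_irrational[OF x])
          have "k (Suc n) \<le> cf_digit ?y" using n by (simp add: E_def)
          then have "real (k (Suc n)) * ?y \<le> 1" using cf_digit_ge_iff[OF y] by blast
          moreover have "2 ^ j / \<psi> (2 ^ (L * Suc n)) * ?y \<le> real (k (Suc n)) * ?y"
            by (intro mult_right_mono k_ge less_imp_le unit_irrationals_bounds(1)[OF y])
          ultimately have "2 ^ j / \<psi> (2 ^ (L * Suc n)) * ?y \<le> 1" by linarith
          moreover have "0 < \<psi> (2 ^ (L * Suc n))" using \<psi>_pos by simp
          ultimately have "2 ^ j * ?y \<le> \<psi> (2 ^ (L * Suc n))"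
            by (simp add: divide_le_eq del: funpow.simps mult_Suc_right)
          with n show "\<exists>n\<ge>N. 2 ^ j * (gauss_map ^^ n) x \<le> \<psi> (2 ^ (L * n))"
            by (intro exI[of _ "Suc n"]) auto
        qed
      qed
    qed
    then have "AE x in \<mu>. \<forall>j. frequently (\<lambda>n. 2 ^ j * (gauss_map ^^ n) x \<le> \<psi> (2 ^ (L * n))) sequentially"
      by (simp add: AE_all_countable)
    then show ?thesis using den_bound AE_space
    proof eventually_elim
      case (elim x)
      then have x: "x \<in> unit_irrationals" by (simp add: space_\<mu>)
      have freq: "frequently (\<lambda>q. ereal (approx_ratio f x q) \<le> ereal (1 / 2 ^ j)) sequentially" for j
        unfolding frequently_sequentially
      proof
        fix N
        \<comment> \<open>The condition \<open>2 * N \<le> n\<close> makes the denominator at least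
          \<open>2 ^ N\<close>, hence larger than \<open>N\<close>.\<close>
        have "frequently (\<lambda>n. (cf_den x (Suc n) \<le> 2 ^ (L * n) \<and> 2 * N \<le> n) \<and>
            2 ^ j * (gauss_map ^^ n) x \<le> \<psi> (2 ^ (L * n))) sequentially"
          using elim(1) elim(2) eventually_ge_at_top[of "2 * N"]
          by (intro frequently_eventually_conj eventually_conj) auto
        then obtain n where n: "2 ^ j * (gauss_map ^^ n) x \<le> \<psi> (2 ^ (L * n))"
            "cf_den x (Suc n) \<le> 2 ^ (L * n)" "2 * N \<le> n"
          using frequently_ex by blast
        define q where "q = cf_den x (Suc n)"
        have q1: "1 \<le> q" "N \<le> q"
        proof -
          have "2 ^ N \<le> (2::nat) ^ (n div 2)" using n(3) by (intro power_increasing) auto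
          then have "2 ^ N \<le> q" unfolding q_def using cf_den_ge_power[OF x, of n] by linarith
          with less_exp[of N] one_le_power[of "2::nat" N] show "1 \<le> q" "N \<le> q" by linarith+
        qed
        have "real q * cf_gap x (Suc n) \<le> (gauss_map ^^ n) x"
          unfolding q_def by (rule cf_den_gap_le[OF x])
        then have "2 ^ j * (real q * cf_gap x (Suc n)) \<le> 2 ^ j * (gauss_map ^^ n) x" by simp
        \<comment> \<open>The upper bound \<open>q \<le> 2 ^ (L * n)\<close> on the denominator
          enters here, through monotonicity of \<open>\<psi>\<close>.\<close>
        also have "\<dots> \<le> \<psi> q" using n \<psi>_mono[OF q1(1)] unfolding q_def[symmetric] by fastforce
        finally have "real q * (2 ^ j * cf_gap x (Suc n)) \<le> real q * f q" by (simp add: \<psi>_def mult_ac)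
        then have le: "2 ^ j * cf_gap x (Suc n) \<le> f q" using q1 by simp
        have "approx_ratio f x q \<le> \<bar>real q * x - of_int (int (cf_num x (Suc n)))\<bar> / f q"
          by (intro approx_ratio_le q1 assms(5))
        also have "\<dots> = cf_gap x (Suc n) / f q"
          using cf_den_mult_minus_cf_num[OF x, of "Suc n"] cf_gap_pos[OF x, of "Suc n"]
          by (simp add: q_def abs_mult power_abs)
        also have "\<dots> \<le> 1 / 2 ^ j"
          using le assms(5)[OF q1(1)] by (simp add: field_simps)
        finally show "\<exists>q\<ge>N. ereal (approx_ratio f x q) \<le> ereal (1 / 2 ^ j)"
          using q1 by auto
      qed
      have nonneg: "0 \<le> approx_ratio f x q" if "1 \<le> q" for q
        using approx_ratio_attained[OF that, of f x] assms(5)[OF that]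
        by (metis abs_ge_zero divide_nonneg_pos)
      have "0 \<le> liminf (\<lambda>q. ereal (approx_ratio f x q))"
        using nonneg by (intro Liminf_bounded) (auto simp: eventually_sequentially)
      moreover have "liminf (\<lambda>q. ereal (approx_ratio f x q)) \<le> 0"
      proof (rule ccontr)
        assume "\<not> ?thesis"
        then obtain y where y: "0 < ereal y" "ereal y < liminf (\<lambda>q. ereal (approx_ratio f x q))"
          using ereal_dense2 by (metis not_le)
        obtain j where j: "(1 / 2) ^ j < y" using y real_arch_pow_inv[of y "1 / 2"] by auto
        have "eventually (\<lambda>q. ereal y < ereal (approx_ratio f x q)) sequentially"
          by (rule less_LiminfD[OF y(2)])
        then have "eventually (\<lambda>q. \<not> ereal (approx_ratio f x q) \<le> ereal (1 / 2 ^ j)) sequentially"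
          using j by (auto simp: power_one_over elim!: eventually_mono)
        then show False using freq[of j] by (simp add: frequently_def)
      qed
      ultimately show ?case by (rule antisym[rotated])
    qed
  qed

  show ?thesis
    unfolding condensed using convergent_part divergent_part by blast
qed

end
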